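(* Let $a>0$ and let $\mathrm{Ch}_n(z;a)$, $n\in\mathbb{Z}_+$, be the generalized Chebyshev polynomials defined in the context. For $z\in\mathbb{C}\setminus[-1,1]$ set $$\gamma_\pm(z;a)=\frac a2\pm\frac{a^2-2}{2a}\,\frac{z}{\sqrt{z^2-1}}.$$ Then $$\mathrm{Ch}_n(z;a)=\gamma_+(z;a)\,\omega(z)^n+\gamma_-(z;a)\,\omega(z)^{-n}\qquad\text{for all } n\ge1.$$
   Context: The polynomials $\mathrm{Ch}_n(z;a)$ are defined by $\mathrm{Ch}_0(z;a)=1$, $\mathrm{Ch}_1(z;a)=2a^{-1}z$, $$a\,\mathrm{Ch}_0(z;a)+\mathrm{Ch}_2(z;a)=2z\,\mathrm{Ch}_1(z;a),\qquad \mathrm{Ch}_{n-1}(z;a)+\mathrm{Ch}_{n+1}(z;a)=2z\,\mathrm{Ch}_n(z;a)\ \ (n\ge2).$$ The branch of $\sqrt{z^2-1}$ is analytic on $\mathbb{C}\setminus[-1,1]$ and positive for $z>1$, and $\omega(z)=z-\sqrt{z^2-1}=(z+\sqrt{z^2-1})^{-1}$. *)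

theory Defs
  imports "HOL-Analysis.Analysis" "HOL-Computational_Algebra.Polynomial"
begin

text \<open>The defining recurrences, solved for the polynomial of highest index; the one giving
  $\mathrm{Ch}_2$ is exceptional.\<close>

fun Ch :: "real \<Rightarrow> nat \<Rightarrow> complex poly" where
  "Ch a 0 = 1"
| "Ch a (Suc 0) = [:0, 2 * inverse (of_real a):]"
| "Ch a (Suc (Suc 0)) = [:0, 2:] * Ch a 1 - smult (of_real a) (Ch a 0)"
| "Ch a (Suc (Suc (Suc n))) = [:0, 2:] * Ch a (Suc (Suc n)) - Ch a (Suc n)"

definition branch_cut :: "complex set" where
  "branch_cut = complex_of_real ` {-1..1}"

definition is_sqrt_branch :: "(complex \<Rightarrow> complex) \<Rightarrow> bool" where
  "is_sqrt_branch s \<longleftrightarrow>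
     s analytic_on (- branch_cut) \<and>
     (\<forall>z \<in> - branch_cut. s z ^ 2 = z ^ 2 - 1) \<and>
     (\<forall>x::real. x > 1 \<longrightarrow> s (of_real x) \<in> \<real> \<and> Re (s (of_real x)) > 0)"

lemma branch_cut_eq_segment: "branch_cut = closed_segment (-1) 1"
  using closed_segment_of_real[of "-1" 1, where ?'a = complex]
  by (simp add: branch_cut_def closed_segment_eq_real_ivl)

lemma open_Compl_branch_cut: "open (- branch_cut)"
  by (simp add: branch_cut_eq_segment open_Compl)

lemma is_sqrt_branch_exists: "\<exists>s. is_sqrt_branch s"
proof
  let ?s = "\<lambda>z::complex. z * csqrt (1 - 1 / z ^ 2)"
  have nz: "z \<noteq> 0" if "z \<in> - branch_cut" for z
    using that by (force simp: branch_cut_def)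
  have dom: "1 - 1 / z ^ 2 \<notin> \<real>\<^sub>\<le>\<^sub>0" if z: "z \<in> - branch_cut" for z
  proof
    assume "1 - 1 / z ^ 2 \<in> \<real>\<^sub>\<le>\<^sub>0"
    then obtain t where t: "t \<le> 0" "1 - 1 / z ^ 2 = of_real t"
      by (auto elim: nonpos_Reals_cases)
    define r where "r = sqrt (1 / (1 - t))"
    have r2: "r ^ 2 = 1 / (1 - t)" and r: "0 \<le> r" "r \<le> 1"
      using t(1) by (auto simp: r_def)
    have "1 / z ^ 2 = of_real (1 - t)"
      using t(2) by (simp add: algebra_simps)
    hence "z ^ 2 = inverse (of_real (1 - t))"
      by (metis inverse_eq_divide inverse_inverse_eq)
    also have "\<dots> = of_real r ^ 2"
      by (simp only: r2 of_real_power[symmetric] of_real_inverse[symmetric])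
        (simp add: inverse_eq_divide)
    finally have "z = of_real r \<or> z = of_real (- r)"
      by (simp add: power2_eq_iff)
    moreover have "r \<in> {-1..1}" "- r \<in> {-1..1}"
      using r by auto
    ultimately show False
      using z unfolding branch_cut_def by blast
  qed
  have "?s holomorphic_on (- branch_cut)"
    using nz dom by (intro holomorphic_intros) auto
  hence "?s analytic_on (- branch_cut)"
    by (simp add: analytic_on_open open_Compl_branch_cut)
  moreover have "?s z ^ 2 = z ^ 2 - 1" if "z \<in> - branch_cut" for z
    using nz[OF that] by (simp add: power_mult_distrib field_simps)
  moreover have "?s (of_real x) \<in> \<real> \<and> Re (?s (of_real x)) > 0" if "x > 1" for x :: real
  proof -
    have "1 / x ^ 2 < 1"
      using that by simp
    hence p: "0 < 1 - 1 / x ^ 2"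
      by simp
    have "csqrt (of_real (1 - 1 / x ^ 2)) = of_real (sqrt (1 - 1 / x ^ 2))"
      using p by (intro of_real_sqrt[symmetric]) simp
    hence "?s (of_real x) = of_real (x * sqrt (1 - 1 / x ^ 2))"
      by simp
    thus ?thesis
      using p that by (simp only: Re_complex_of_real Reals_of_real) simp
  qed
  ultimately show "is_sqrt_branch ?s"
    unfolding is_sqrt_branch_def by blast
qed

lemma is_sqrt_branch_unique:
  assumes s: "is_sqrt_branch s" and t: "is_sqrt_branch t" and z: "z \<in> - branch_cut"
  shows "s z = t z"
proof -
  have t0: "t w \<noteq> 0" if "w \<in> - branch_cut" for w
  proof
    assume "t w = 0"
    moreover have "t w ^ 2 = w ^ 2 - 1"
      using t that unfolding is_sqrt_branch_def by blast
    ultimately have "w ^ 2 = 1 ^ 2"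
      by simp
    hence "w = of_real 1 \<or> w = of_real (- 1)"
      by (simp only: power2_eq_iff) simp
    thus False
      using that unfolding branch_cut_def by fastforce
  qed
  have conn: "connected (- branch_cut)"
    unfolding branch_cut_eq_segment
    by (intro connected_complement_bounded_convex) (auto intro: compact_imp_bounded)
  have cont: "continuous_on (- branch_cut) (\<lambda>w. s w / t w)"
    using s t t0
    by (intro continuous_on_divide)
      (auto simp: is_sqrt_branch_def intro: analytic_imp_holomorphic holomorphic_on_imp_continuous_on)
  have "(s w / t w) ^ 2 = 1 ^ 2" if "w \<in> - branch_cut" for w
  proof -
    have "s w ^ 2 = t w ^ 2"
      using s t that by (simp add: is_sqrt_branch_def)
    thus ?thesis
      using t0[OF that] by (simp add: power_divide)
  qed
  hence "(\<lambda>w. s w / t w) ` (- branch_cut) \<subseteq> {1, - 1}"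
    unfolding power2_eq_iff by blast
  hence "finite ((\<lambda>w. s w / t w) ` (- branch_cut))"
    by (rule finite_subset) simp
  then have const: "(\<lambda>w. s w / t w) constant_on (- branch_cut)"
    using continuous_finite_range_constant[OF conn cont] by simp
  have 2: "complex_of_real 2 \<in> - branch_cut"
    unfolding branch_cut_def by (auto simp del: of_real_numeral)
  have pos: "\<exists>p. f (of_real 2) = complex_of_real p \<and> p > 0" if "is_sqrt_branch f" for f
  proof -
    have "f (of_real 2) \<in> \<real>" "Re (f (of_real 2)) > 0"
      using that unfolding is_sqrt_branch_def by (meson one_less_numeral_iff semiring_norm(76))+
    thus ?thesis
      by (metis of_real_Re)
  qed
  obtain p where p: "s (of_real 2) = of_real p" "p > 0"
    using pos[OF s] by blast
  obtain q where q: "t (of_real 2) = of_real q" "q > 0"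
    using pos[OF t] by blast
  have "s (of_real 2) ^ 2 = t (of_real 2) ^ 2"
    using s t 2 by (simp add: is_sqrt_branch_def del: of_real_numeral)
  hence "p ^ 2 = q ^ 2"
    unfolding p q by (simp only: of_real_power[symmetric] of_real_eq_iff)
  hence "s (of_real 2) / t (of_real 2) = 1"
    using p q by (auto simp: power2_eq_iff simp del: of_real_numeral)
  moreover obtain c where "\<And>w. w \<in> - branch_cut \<Longrightarrow> s w / t w = c"
    using const unfolding constant_on_def by blast
  ultimately have "s z / t z = 1"
    using 2 z by force
  thus ?thesis
    using t0[OF z] by simp
qed

text \<open>The branch of $\sqrt{z^2-1}$ is specified by its properties. By the two preceding lemmas such a
  function exists and its values off \<open>[-1,1]\<close> do not depend on the choice; values on \<open>[-1,1]\<close> are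
  irrelevant.\<close>

definition sqrt_branch :: "complex \<Rightarrow> complex" where
  "sqrt_branch = (SOME s. is_sqrt_branch s)"

lemma is_sqrt_branch_sqrt_branch: "is_sqrt_branch sqrt_branch"
  unfolding sqrt_branch_def by (rule someI_ex[OF is_sqrt_branch_exists])

definition omega :: "complex \<Rightarrow> complex" where
  "omega z = z - sqrt_branch z"

lemma omega_eq_inverse:
  assumes "z \<in> - branch_cut"
  shows "omega z = inverse (z + sqrt_branch z)"
proof -
  have "omega z * (z + sqrt_branch z) = z ^ 2 - sqrt_branch z ^ 2"
    by (simp add: omega_def algebra_simps power2_eq_square)
  also have "\<dots> = 1"
    using is_sqrt_branch_sqrt_branch assms by (simp add: is_sqrt_branch_def)
  finally show ?thesis
    by (metis inverse_unique mult.commute)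
qed

definition gamma_plus :: "complex \<Rightarrow> real \<Rightarrow> complex" where
  "gamma_plus z a =
     of_real a / 2 + of_real ((a ^ 2 - 2) / (2 * a)) * (z / sqrt_branch z)"

definition gamma_minus :: "complex \<Rightarrow> real \<Rightarrow> complex" where
  "gamma_minus z a =
     of_real a / 2 - of_real ((a ^ 2 - 2) / (2 * a)) * (z / sqrt_branch z)"

end

theory Submission
  imports Defs
begin

text \<open>Both \<open>z - \<surd>(z\<^sup>2 - 1)\<close> and \<open>z + \<surd>(z\<^sup>2 - 1)\<close> are roots of \<open>x\<^sup>2 = 2 z x - 1\<close>, so every
  combination of their powers satisfies the three-term recurrence. The coefficients
  \<open>\<gamma>\<^sub>\<plusminus>\<close> are those giving the value \<open>2 z / a\<close> at \<open>n = 1\<close> and \<open>a\<close> at \<open>n = 0\<close>. The latter is not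
  \<open>Ch\<^sub>0\<close>, but the exceptional relation for \<open>Ch\<^sub>2\<close> is the regular one with \<open>Ch\<^sub>0\<close> replaced by \<open>a\<close>.\<close>

lemma sqrt_branch_power2:
  assumes "z \<in> - branch_cut"
  shows "sqrt_branch z ^ 2 = z ^ 2 - 1"
  using is_sqrt_branch_sqrt_branch assms by (simp add: is_sqrt_branch_def)

text \<open>The zeros 1 and -1 of \<open>z ^ 2 - 1\<close> are the endpoints of the cut.\<close>

lemma sqrt_branch_nonzero:
  assumes "z \<in> - branch_cut"
  shows "sqrt_branch z \<noteq> 0"
proof
  assume "sqrt_branch z = 0"
  hence "z ^ 2 = 1"
    using sqrt_branch_power2[OF assms] by simp
  hence "z = of_real 1 \<or> z = of_real (- 1)"
    by (simp add: power2_eq_1_iff)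
  thus False
    using assms unfolding branch_cut_def by fastforce
qed

lemma power_recurrence_of_root:
  fixes x z :: "'a::comm_ring_1"
  assumes "x ^ 2 = 2 * z * x - 1"
  shows "x ^ Suc (Suc n) = 2 * z * x ^ Suc n - x ^ n"
proof -
  have "x ^ Suc (Suc n) = x ^ 2 * x ^ n"
    by (simp add: power2_eq_square mult.assoc)
  also have "\<dots> = 2 * z * x ^ Suc n - x ^ n"
    unfolding assms by (simp add: algebra_simps)
  finally show ?thesis .
qed

lemma Ch_eq_of_recurrence:
  fixes f :: "nat \<Rightarrow> complex"
  assumes f0: "f 0 = of_real a" and f1: "f 1 = 2 * z / of_real a"
    and rec: "\<And>n. f (Suc (Suc n)) = 2 * z * f (Suc n) - f n"
  shows "poly (Ch a (Suc n)) z = f (Suc n)"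
proof (induction n rule: less_induct)
  case (less n)
  have f1': "f (Suc 0) = 2 * z / of_real a"
    using f1 by simp
  consider "n = 0" | "n = Suc 0" | m where "n = Suc (Suc m)"
    by (metis not0_implies_Suc)
  thus ?case
  proof cases
    case 1
    thus ?thesis
      by (simp add: f1' divide_inverse)
  next
    \<comment> \<open>The exceptional relation subtracts \<open>a * Ch a 0\<close>, which is
      \<open>a\<close>, hence \<open>f 0\<close>.\<close>
    case 2
    thus ?thesis
      by (simp add: rec f0 f1' divide_inverse)
  next
    case 3
    thus ?thesis
      using less.IH[of m] less.IH[of "Suc m"] rec[of "Suc m"] by simp
  qed
qed

theorem proposition3p2:
  fixes a :: real and z :: complex and n :: nat
  assumes "a > 0" and "z \<in> - branch_cut" and "n \<ge> 1"
  shows "poly (Ch a n) z =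
    gamma_plus z a * omega z ^ n + gamma_minus z a * omega z powi (- int n)"
proof -
  define s where "s = sqrt_branch z"
  \<comment> \<open>As \<open>z + s\<close> is the reciprocal of \<open>omega z\<close>, natural
    exponents suffice.\<close>
  define f where "f k = gamma_plus z a * (z - s) ^ k + gamma_minus z a * (z + s) ^ k" for k
  have s2: "s ^ 2 = z ^ 2 - 1" and s0: "s \<noteq> 0"
    using sqrt_branch_power2 sqrt_branch_nonzero assms(2) by (auto simp: s_def)
  have roots: "(z - s) ^ 2 = 2 * z * (z - s) - 1" "(z + s) ^ 2 = 2 * z * (z + s) - 1"
    using s2 by (simp_all add: power2_eq_square algebra_simps)
  have "f 0 = of_real a"
    by (simp add: f_def gamma_plus_def gamma_minus_def)
  \<comment> \<open>The factor \<open>s\<close> cancels, leaving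
    \<open>a * z - ((a ^ 2 - 2) / a) * z\<close>.\<close>
  moreover have "f 1 = 2 * z / of_real a"
    using s0 assms(1)
    by (simp add: f_def gamma_plus_def gamma_minus_def s_def[symmetric] field_simps power2_eq_square)
  moreover have "f (Suc (Suc k)) = 2 * z * f (Suc k) - f k" for k
    unfolding f_def roots[THEN power_recurrence_of_root] by (simp add: algebra_simps)
  ultimately have "poly (Ch a (Suc (n - 1))) z = f (Suc (n - 1))"
    by (rule Ch_eq_of_recurrence)
  moreover have "omega z powi (- int n) = (z + s) ^ n"
    using omega_eq_inverse[OF assms(2)] by (simp add: power_int_minus power_inverse s_def)
  ultimately show ?thesis
    using assms(3) by (simp add: f_def omega_def s_def)
qed

end
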